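(* Let $m\neq0$ and let $\phi_{m,j}$ be a joint eigenfunction of weight $m$ on $P_h$, the lift of the eigensection $f_{m,j}e_L^m$ of $L^m$. Let $\mathcal{Z}_{f_{m,j}}\subset X$ be the zero set of $f_{m,j}$ and $\Sigma=\pi^{-1}(\mathcal{Z}_{f_{m,j}})$. Let $\mathcal{N}_{\Re\phi_{m,j}}=\{p\in P_h:\Re\phi_{m,j}(p)=0\}$ and $\mathcal{N}_{\Im\phi_{m,j}}=\{p\in P_h:\Im\phi_{m,j}(p)=0\}$. Then the maps $$\pi:\mathcal{N}_{\Re\phi_{m,j}}\setminus\Sigma\to X\setminus\mathcal{Z}_{f_{m,j}},\qquad \pi:\mathcal{N}_{\Im\phi_{m,j}}\setminus\Sigma\to X\setminus\mathcal{Z}_{f_{m,j}}$$ are $2|m|$-fold covering spaces.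
   Context: $X$ is a compact connected surface with Riemannian metric $g$ and compatible complex structure; $(L,h)\to X$ is a holomorphic line bundle with Hermitian metric $h$ and $h$-compatible connection $\nabla$; $P_h=\{(z,\lambda)\in L^*:|\lambda|_{h^*}=1\}$ with projection $\pi:P_h\to X$ and generator $\partial/\partial\theta$ of the $S^1$ action. With $TP_h=H\oplus V$ the splitting given by $\nabla$, the Kaluza-Klein metric $G$ is the $S^1$-invariant metric with $H\perp V$, $d\pi:H_p\to T_{\pi(p)}X$ isometric and $|\partial/\partial\theta|_G=1$. Joint eigenfunctions satisfy $\Delta_G\phi_{m,j}=-\lambda_{m,j}\phi_{m,j}$ and $\frac{\partial}{\partial\theta}\phi_{m,j}=im\phi_{m,j}$, $m\in\mathbb{Z}$. A section $s$ of $L^m$ corresponds to the weight $m$ function $\hat s(z,\lambda)=\lambda^m(s(z))$ on $P_h$; $e_L$ is a local frame of $L$. *)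

theory Defs
  imports "HOL-Analysis.Analysis"
begin

section \<open>Smooth functions\<close>

text \<open>Meant for open \<^term>\<open>S\<close>: \<open>f\<close> is differentiable and all its partial derivatives are
  \<open>C\<^sup>k\<close>.\<close>

primrec ck_on :: "nat \<Rightarrow> ('a::euclidean_space \<Rightarrow> 'b::real_normed_vector) \<Rightarrow> 'a set \<Rightarrow> bool" where
  "ck_on 0 f S \<longleftrightarrow> continuous_on S f"
| "ck_on (Suc k) f S \<longleftrightarrow>
     (\<forall>x\<in>S. f differentiable (at x)) \<and>
     (\<forall>b\<in>Basis. ck_on k (\<lambda>x. frechet_derivative f (at x) b) S)"

definition smooth_on :: "('a::euclidean_space \<Rightarrow> 'b::real_normed_vector) \<Rightarrow> 'a set \<Rightarrow> bool" where
  "smooth_on f S \<longleftrightarrow> (\<forall>k. ck_on k f S)"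


section \<open>Riemann surfaces and compatible Riemannian metrics\<close>

text \<open>The surface is the type \<open>'x\<close>. A chart is a pair of a domain and a coordinate function whose
  values off the domain are irrelevant.\<close>

type_synonym 'x chart = "'x set \<times> ('x \<Rightarrow> complex)"

definition param :: "'x chart \<Rightarrow> complex \<Rightarrow> 'x" where
  "param c = inv_into (fst c) (snd c)"

definition chart_change :: "'x chart \<Rightarrow> 'x chart \<Rightarrow> complex \<Rightarrow> complex" where
  "chart_change c c' = snd c' \<circ> param c"

definition riemann_surface :: "'x::topological_space chart set \<Rightarrow> bool" where
  "riemann_surface atlas \<longleftrightarrow>
     (\<Union>c\<in>atlas. fst c) = UNIV \<and>
     (\<forall>c\<in>atlas. open (fst c) \<and> open (snd c ` fst c) \<and>
        homeomorphism (fst c) (snd c ` fst c) (snd c) (param c)) \<and>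
     (\<forall>c\<in>atlas. \<forall>c'\<in>atlas. chart_change c c' holomorphic_on snd c ` (fst c \<inter> fst c'))"

text \<open>A tensor field is given by its components in every chart: \<open>g c z v w\<close> is the value at the point
  with coordinate \<open>z\<close> on the tangent vectors with components \<open>v\<close>, \<open>w\<close> in \<open>\<complex> = \<real>\<^sup>2\<close>.
  The differential of a holomorphic chart change is multiplication by its complex derivative.\<close>

type_synonym 'x metric = "'x chart \<Rightarrow> complex \<Rightarrow> complex \<Rightarrow> complex \<Rightarrow> real"

definition riemannian_metric :: "'x chart set \<Rightarrow> 'x metric \<Rightarrow> bool" where
  "riemannian_metric atlas g \<longleftrightarrow>
     (\<forall>c\<in>atlas.
        (\<forall>z\<in>snd c ` fst c. bilinear (g c z) \<and> (\<forall>v w. g c z v w = g c z w v) \<and>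
           (\<forall>v. v \<noteq> 0 \<longrightarrow> 0 < g c z v v)) \<and>
        (\<forall>v w. smooth_on (\<lambda>z. g c z v w) (snd c ` fst c))) \<and>
     (\<forall>c\<in>atlas. \<forall>c'\<in>atlas. \<forall>z\<in>snd c ` (fst c \<inter> fst c'). \<forall>v w.
        g c z v w = g c' (chart_change c c' z)
                      (deriv (chart_change c c') z * v) (deriv (chart_change c c') z * w))"

text \<open>Compatibility of the metric with the complex structure: \<open>J = \<i>\<close> is an isometry.\<close>

definition complex_compatible :: "'x chart set \<Rightarrow> 'x metric \<Rightarrow> bool" where
  "complex_compatible atlas g \<longleftrightarrow>
     (\<forall>c\<in>atlas. \<forall>z\<in>snd c ` fst c. \<forall>v w. g c z (\<i> * v) (\<i> * w) = g c z v w)"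


section \<open>Hermitian holomorphic line bundles with connection\<close>

text \<open>A local trivialization over \<open>U\<close> is a fibrewise linear fibre coordinate
  \<open>\<pi>\<^sup>-\<^sup>1(U) \<rightarrow> \<complex>\<close>; it corresponds to the local frame on which it takes the value 1.\<close>

type_synonym ('x, 'l) triv = "'x set \<times> ('l \<Rightarrow> complex)"

record ('x, 'l) line_bundle =
  proj :: "'l \<Rightarrow> 'x"
  fadd :: "'l \<Rightarrow> 'l \<Rightarrow> 'l"
  fscale :: "complex \<Rightarrow> 'l \<Rightarrow> 'l"
  trivs :: "('x, 'l) triv set"

definition frame :: "('x, 'l) line_bundle \<Rightarrow> ('x, 'l) triv \<Rightarrow> 'x \<Rightarrow> 'l" where
  "frame L T p = (THE v. proj L v = p \<and> snd T v = 1)"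

text \<open>The transition function \<open>\<gamma>\<close> with \<open>e\<^sub>T = \<gamma> e\<^sub>T\<^sub>'\<close>.\<close>

definition transition ::
    "('x, 'l) line_bundle \<Rightarrow> ('x, 'l) triv \<Rightarrow> ('x, 'l) triv \<Rightarrow> 'x \<Rightarrow> complex" where
  "transition L T T' p = snd T' (frame L T p)"

text \<open>The trivializations turn every fibre into a complex line and determine the topology and the
  complex structure of the total space, so these are not separate data.\<close>

definition holomorphic_line_bundle ::
    "'x::topological_space chart set \<Rightarrow> ('x, 'l) line_bundle \<Rightarrow> bool" where
  "holomorphic_line_bundle atlas L \<longleftrightarrow>
     (\<Union>T\<in>trivs L. fst T) = UNIV \<and>
     (\<forall>T\<in>trivs L. open (fst T) \<and>
        bij_betw (\<lambda>v. (proj L v, snd T v)) (proj L -` fst T) (fst T \<times> UNIV) \<and>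
        (\<forall>u v a. proj L v \<in> fst T \<and> proj L u = proj L v \<longrightarrow>
           proj L (fadd L u v) = proj L v \<and> snd T (fadd L u v) = snd T u + snd T v \<and>
           proj L (fscale L a v) = proj L v \<and> snd T (fscale L a v) = a * snd T v)) \<and>
     (\<forall>T\<in>trivs L. \<forall>T'\<in>trivs L. \<forall>c\<in>atlas.
        (transition L T T' \<circ> param c) holomorphic_on snd c ` (fst c \<inter> fst T \<inter> fst T'))"

text \<open>\<open>h u v\<close> is only meaningful for \<open>u\<close>, \<open>v\<close> in the same fibre; it is linear in the first
  argument. The zero vector in the fibre of \<open>u\<close> is \<open>fscale L 0 u\<close>.\<close>

definition hermitian_metric ::
    "'x chart set \<Rightarrow> ('x, 'l) line_bundle \<Rightarrow> ('l \<Rightarrow> 'l \<Rightarrow> complex) \<Rightarrow> bool" where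
  "hermitian_metric atlas L h \<longleftrightarrow>
     (\<forall>u v w a. proj L u = proj L w \<and> proj L v = proj L w \<longrightarrow>
        h (fadd L u v) w = h u w + h v w \<and> h (fscale L a u) w = a * h u w \<and>
        h w u = cnj (h u w)) \<and>
     (\<forall>u. u \<noteq> fscale L 0 u \<longrightarrow> 0 < Re (h u u)) \<and>
     (\<forall>T\<in>trivs L. \<forall>c\<in>atlas.
        smooth_on (\<lambda>z. h (frame L T (param c z)) (frame L T (param c z)))
          (snd c ` (fst c \<inter> fst T)))"

text \<open>A connection is given by its complex-valued connection 1-forms: \<open>\<nabla>\<^sub>v e\<^sub>T = A T c z v e\<^sub>T\<close>, where
  \<open>v\<close> is the component in the chart \<open>c\<close> of a tangent vector at the point with coordinate \<open>z\<close>.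
  From \<open>e\<^sub>T = \<gamma> e\<^sub>T\<^sub>'\<close> and the Leibniz rule one gets the gauge law \<open>A\<^sub>T = A\<^sub>T\<^sub>' + \<gamma>\<^sup>-\<^sup>1 d\<gamma>\<close>.\<close>

type_synonym ('x, 'l) connection =
  "('x, 'l) triv \<Rightarrow> 'x chart \<Rightarrow> complex \<Rightarrow> complex \<Rightarrow> complex"

definition connection ::
    "'x chart set \<Rightarrow> ('x, 'l) line_bundle \<Rightarrow> ('x, 'l) connection \<Rightarrow> bool" where
  "connection atlas L A \<longleftrightarrow>
     (\<forall>T\<in>trivs L. \<forall>c\<in>atlas.
        (\<forall>z\<in>snd c ` (fst c \<inter> fst T). linear (A T c z)) \<and>
        (\<forall>v. smooth_on (\<lambda>z. A T c z v) (snd c ` (fst c \<inter> fst T)))) \<and>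
     (\<forall>T\<in>trivs L. \<forall>c\<in>atlas. \<forall>c'\<in>atlas. \<forall>z\<in>snd c ` (fst c \<inter> fst c' \<inter> fst T). \<forall>v.
        A T c z v = A T c' (chart_change c c' z) (deriv (chart_change c c') z * v)) \<and>
     (\<forall>T\<in>trivs L. \<forall>T'\<in>trivs L. \<forall>c\<in>atlas. \<forall>z\<in>snd c ` (fst c \<inter> fst T \<inter> fst T'). \<forall>v.
        A T c z v = A T' c z v +
          deriv (transition L T T' \<circ> param c) z * v / transition L T T' (param c z))"

text \<open>\<open>d h(e,e) = h(\<nabla>e,e) + h(e,\<nabla>e)\<close> for every local frame \<open>e\<close>, that is, \<open>\<nabla>h = 0\<close>.\<close>

definition metric_connection ::
    "'x chart set \<Rightarrow> ('x, 'l) line_bundle \<Rightarrow> ('l \<Rightarrow> 'l \<Rightarrow> complex) \<Rightarrow> ('x, 'l) connection \<Rightarrow> bool" where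
  "metric_connection atlas L h A \<longleftrightarrow>
     (\<forall>T\<in>trivs L. \<forall>c\<in>atlas. \<forall>z\<in>snd c ` (fst c \<inter> fst T). \<forall>v.
        frechet_derivative (\<lambda>y. h (frame L T (param c y)) (frame L T (param c y))) (at z) v =
          A T c z v * h (frame L T (param c z)) (frame L T (param c z)) +
          cnj (A T c z v) * h (frame L T (param c z)) (frame L T (param c z)))"


section \<open>The dual bundle and its unit circle bundle\<close>

text \<open>Points of the dual bundle are pairs of a base point and a linear functional on the fibre over it,
  extended by 0 to the rest of the total space.\<close>

definition dual_bundle :: "('x, 'l) line_bundle \<Rightarrow> ('x \<times> ('l \<Rightarrow> complex)) set" where
  "dual_bundle L = {(p, \<xi>).
     (\<forall>u v a. proj L u = p \<and> proj L v = p \<longrightarrow>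
        \<xi> (fadd L u v) = \<xi> u + \<xi> v \<and> \<xi> (fscale L a u) = a * \<xi> u) \<and>
     (\<forall>v. proj L v \<noteq> p \<longrightarrow> \<xi> v = 0)}"

definition coframe :: "('x, 'l) line_bundle \<Rightarrow> ('x, 'l) triv \<Rightarrow> 'x \<Rightarrow> 'l \<Rightarrow> complex" where
  "coframe L T p = (\<lambda>v. if proj L v = p then snd T v else 0)"

definition rescale :: "complex \<Rightarrow> ('l \<Rightarrow> complex) \<Rightarrow> 'l \<Rightarrow> complex" where
  "rescale a \<xi> = (\<lambda>v. a * \<xi> v)"

text \<open>The bundle topology, in which \<open>(p, a) \<mapsto> a e\<^sub>T\<^sup>*(p)\<close> is a homeomorphism from \<open>U \<times> \<complex>\<close> onto the part
  over \<open>U\<close>, for every trivialization \<open>T\<close> over \<open>U\<close>.\<close>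

definition dual_topology ::
    "('x::topological_space, 'l) line_bundle \<Rightarrow> ('x \<times> ('l \<Rightarrow> complex)) topology" where
  "dual_topology L = topology (\<lambda>W. W \<subseteq> dual_bundle L \<and>
     (\<forall>T\<in>trivs L. open {(p, a). p \<in> fst T \<and> (p, rescale a (coframe L T p)) \<in> W}))"

definition dual_norm ::
    "('x, 'l) line_bundle \<Rightarrow> ('l \<Rightarrow> 'l \<Rightarrow> complex) \<Rightarrow> 'x \<times> ('l \<Rightarrow> complex) \<Rightarrow> real" where
  "dual_norm L h q = (SUP v\<in>{v. proj L v = fst q \<and> sqrt (Re (h v v)) \<le> 1}. cmod (snd q v))"

definition circle_bundle ::
    "('x, 'l) line_bundle \<Rightarrow> ('l \<Rightarrow> 'l \<Rightarrow> complex) \<Rightarrow> ('x \<times> ('l \<Rightarrow> complex)) set" where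
  "circle_bundle L h = {q \<in> dual_bundle L. dual_norm L h q = 1}"

text \<open>Local coordinates \<open>(x, y, \<theta>)\<close> on the circle bundle:
  \<open>(z, e\<^sup>i\<^sup>\<theta> e\<^sub>T\<^sup>*(z) / |e\<^sub>T\<^sup>*(z)|)\<close> with \<open>z = x + i y\<close>.
  The tangent map of the projection is \<open>(x, y, \<theta>) \<mapsto> x + i y\<close> on components as well.\<close>

definition base_part :: "real^3 \<Rightarrow> complex" where
  "base_part x = Complex (x $ 1) (x $ 2)"

definition circle_domain :: "'x chart \<Rightarrow> ('x, 'l) triv \<Rightarrow> (real^3) set" where
  "circle_domain c T = {x. base_part x \<in> snd c ` (fst c \<inter> fst T)}"

definition coframe_coeff ::
    "('x, 'l) line_bundle \<Rightarrow> ('l \<Rightarrow> 'l \<Rightarrow> complex) \<Rightarrow> 'x chart \<Rightarrow> ('x, 'l) triv \<Rightarrow> real^3 \<Rightarrow> complex" where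
  "coframe_coeff L h c T x =
     cis (x $ 3) / of_real (dual_norm L h (param c (base_part x), coframe L T (param c (base_part x))))"

definition circle_param ::
    "('x, 'l) line_bundle \<Rightarrow> ('l \<Rightarrow> 'l \<Rightarrow> complex) \<Rightarrow> 'x chart \<Rightarrow> ('x, 'l) triv \<Rightarrow>
      real^3 \<Rightarrow> 'x \<times> ('l \<Rightarrow> complex)" where
  "circle_param L h c T x = (param c (base_part x),
     rescale (coframe_coeff L h c T x) (coframe L T (param c (base_part x))))"


section \<open>The Kaluza-Klein metric and its Laplacian\<close>

text \<open>The dual connection satisfies \<open>\<nabla> e\<^sup>* = - A e\<^sup>*\<close>, so \<open>\<xi> e\<^sup>*\<close> is parallel in a direction iff
  \<open>d\<xi> - A \<xi> = 0\<close> there. The vertical space, the kernel of the tangent map of the projection, is spanned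
  by \<open>\<partial>/\<partial>\<theta> = axis 3 1\<close>.\<close>

definition horizontal ::
    "('x, 'l) line_bundle \<Rightarrow> ('l \<Rightarrow> 'l \<Rightarrow> complex) \<Rightarrow> ('x, 'l) connection \<Rightarrow>
      'x chart \<Rightarrow> ('x, 'l) triv \<Rightarrow> real^3 \<Rightarrow> (real^3) set" where
  "horizontal L h A c T x =
     {w. frechet_derivative (coframe_coeff L h c T) (at x) w =
           A T c (base_part x) (base_part w) * coframe_coeff L h c T x}"

definition vertical :: "(real^3) set" where
  "vertical = {w. base_part w = 0}"

type_synonym ('x, 'l) circle_metric =
  "'x chart \<Rightarrow> ('x, 'l) triv \<Rightarrow> real^3 \<Rightarrow> real^3 \<Rightarrow> real^3 \<Rightarrow> real"

text \<open>These conditions determine \<open>G\<close> on all coordinate domains, so that its smoothness and its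
  transformation law need not be demanded.\<close>

definition kaluza_klein_metric ::
    "'x chart set \<Rightarrow> 'x metric \<Rightarrow> ('x, 'l) line_bundle \<Rightarrow> ('l \<Rightarrow> 'l \<Rightarrow> complex) \<Rightarrow>
      ('x, 'l) connection \<Rightarrow> ('x, 'l) circle_metric \<Rightarrow> bool" where
  "kaluza_klein_metric atlas g L h A G \<longleftrightarrow>
     (\<forall>c\<in>atlas. \<forall>T\<in>trivs L. \<forall>x\<in>circle_domain c T.
        bilinear (G c T x) \<and> (\<forall>u w. G c T x u w = G c T x w u) \<and>
        (\<forall>w. w \<noteq> 0 \<longrightarrow> 0 < G c T x w w) \<and>
        (\<forall>t. G c T (x + t *\<^sub>R axis 3 1) = G c T x) \<and>
        (\<forall>u\<in>horizontal L h A c T x. \<forall>w\<in>vertical. G c T x u w = 0) \<and>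
        (\<forall>u\<in>horizontal L h A c T x. \<forall>w\<in>horizontal L h A c T x.
           G c T x u w = g c (base_part x) (base_part u) (base_part w)) \<and>
        sqrt (G c T x (axis 3 1) (axis 3 1)) = 1)"

definition gram :: "(real^'n \<Rightarrow> real^'n \<Rightarrow> real) \<Rightarrow> real^'n^'n" where
  "gram B = (\<chi> i j. B (axis i 1) (axis j 1))"

definition partial :: "'n::finite \<Rightarrow> (real^'n \<Rightarrow> complex) \<Rightarrow> real^'n \<Rightarrow> complex" where
  "partial i f x = frechet_derivative f (at x) (axis i 1)"

text \<open>The coordinate expression
  \<open>|G|\<^sup>-\<^sup>1\<^sup>/\<^sup>2 \<Sum>\<^sub>i\<^sub>j \<partial>\<^sub>i (|G|\<^sup>1\<^sup>/\<^sup>2 G\<^sup>i\<^sup>j \<partial>\<^sub>j f)\<close> of the (nonpositive) Laplacian.\<close>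

definition laplacian ::
    "(real^'n \<Rightarrow> real^'n \<Rightarrow> real^'n \<Rightarrow> real) \<Rightarrow> (real^'n \<Rightarrow> complex) \<Rightarrow> real^'n \<Rightarrow> complex" where
  "laplacian B f x = of_real (1 / sqrt (det (gram (B x)))) *
     (\<Sum>i\<in>UNIV. \<Sum>j\<in>UNIV. partial i
        (\<lambda>y. of_real (sqrt (det (gram (B y))) * matrix_inv (gram (B y)) $ i $ j) * partial j f y) x)"

text \<open>Functions on the circle bundle are functions on \<open>'x \<times> ('l \<Rightarrow> complex)\<close> whose values elsewhere are
  irrelevant. The derivative along \<open>\<partial>/\<partial>\<theta>\<close> is taken along the orbits of the circle action.\<close>

definition joint_eigenfunction ::
    "'x chart set \<Rightarrow> ('x, 'l) line_bundle \<Rightarrow> ('l \<Rightarrow> 'l \<Rightarrow> complex) \<Rightarrow> ('x, 'l) circle_metric \<Rightarrow>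
      real \<Rightarrow> int \<Rightarrow> ('x \<times> ('l \<Rightarrow> complex) \<Rightarrow> complex) \<Rightarrow> bool" where
  "joint_eigenfunction atlas L h G \<mu> m \<phi> \<longleftrightarrow>
     (\<forall>c\<in>atlas. \<forall>T\<in>trivs L. smooth_on (\<phi> \<circ> circle_param L h c T) (circle_domain c T)) \<and>
     (\<exists>q\<in>circle_bundle L h. \<phi> q \<noteq> 0) \<and>
     (\<forall>c\<in>atlas. \<forall>T\<in>trivs L. \<forall>x\<in>circle_domain c T.
        laplacian (G c T) (\<phi> \<circ> circle_param L h c T) x = - of_real \<mu> * \<phi> (circle_param L h c T x)) \<and>
     (\<forall>(p, \<xi>)\<in>circle_bundle L h.
        ((\<lambda>\<theta>::real. \<phi> (p, rescale (cis \<theta>) \<xi>)) has_vector_derivative \<i> * of_int m * \<phi> (p, \<xi>)) (at 0))"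


section \<open>Sections of powers of the bundle, and their lifts\<close>

text \<open>A section of \<open>L\<^sup>m\<close> is given by its coefficients with respect to all local frames: it equals
  \<open>f T e\<^sub>T\<^sup>m\<close> over the domain of \<open>T\<close>. For negative \<open>m\<close>, \<open>L\<^sup>m\<close> is a power of the dual and
  \<open>e\<^sub>T\<^sup>m = (e\<^sub>T\<^sup>*)\<^sup>|\<^sup>m\<^sup>|\<close>.\<close>

definition power_section ::
    "'x chart set \<Rightarrow> ('x, 'l) line_bundle \<Rightarrow> int \<Rightarrow> (('x, 'l) triv \<Rightarrow> 'x \<Rightarrow> complex) \<Rightarrow> bool" where
  "power_section atlas L m f \<longleftrightarrow>
     (\<forall>T\<in>trivs L. \<forall>c\<in>atlas. smooth_on (f T \<circ> param c) (snd c ` (fst c \<inter> fst T))) \<and>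
     (\<forall>T\<in>trivs L. \<forall>T'\<in>trivs L. \<forall>p\<in>fst T \<inter> fst T'.
        f T' p = transition L T T' p powi m * f T p)"

text \<open>\<open>\<phi>\<close> is the function \<open>(p, \<xi>) \<mapsto> \<xi>\<^sup>m(s(p))\<close> on the circle bundle, where \<open>s = f\<^sub>T e\<^sub>T\<^sup>m\<close>.\<close>

definition lift_of ::
    "('x, 'l) line_bundle \<Rightarrow> ('l \<Rightarrow> 'l \<Rightarrow> complex) \<Rightarrow> int \<Rightarrow> (('x, 'l) triv \<Rightarrow> 'x \<Rightarrow> complex) \<Rightarrow>
      ('x \<times> ('l \<Rightarrow> complex) \<Rightarrow> complex) \<Rightarrow> bool" where
  "lift_of L h m f \<phi> \<longleftrightarrow>
     (\<forall>(p, \<xi>)\<in>circle_bundle L h. \<forall>T\<in>trivs L. p \<in> fst T \<longrightarrow>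
        \<phi> (p, \<xi>) = f T p * \<xi> (frame L T p) powi m)"

definition section_zeros ::
    "('x, 'l) line_bundle \<Rightarrow> (('x, 'l) triv \<Rightarrow> 'x \<Rightarrow> complex) \<Rightarrow> 'x set" where
  "section_zeros L f = {p. \<exists>T\<in>trivs L. p \<in> fst T \<and> f T p = 0}"


section \<open>Covering maps\<close>

text \<open>The library's \<^const>\<open>covering_space\<close>, for abstract topologies; see
  \<open>covering_map_top_of_set\<close> below.\<close>

definition covering_map :: "'a topology \<Rightarrow> 'b topology \<Rightarrow> ('a \<Rightarrow> 'b) \<Rightarrow> bool" where
  "covering_map X Y f \<longleftrightarrow>
     continuous_map X Y f \<and> f ` topspace X = topspace Y \<and>
     (\<forall>y\<in>topspace Y. \<exists>T. y \<in> T \<and> openin Y T \<and>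
        (\<exists>V. \<Union>V = topspace X \<inter> f -` T \<and> (\<forall>U\<in>V. openin X U) \<and> pairwise disjnt V \<and>
           (\<forall>U\<in>V. homeomorphic_map (subtopology X U) (subtopology Y T) f)))"

definition n_fold_covering_map :: "nat \<Rightarrow> 'a topology \<Rightarrow> 'b topology \<Rightarrow> ('a \<Rightarrow> 'b) \<Rightarrow> bool" where
  "n_fold_covering_map n X Y f \<longleftrightarrow>
     covering_map X Y f \<and>
     (\<forall>y\<in>topspace Y. finite {x\<in>topspace X. f x = y} \<and> card {x\<in>topspace X. f x = y} = n)"

lemma covering_map_top_of_set:
  "covering_map (top_of_set C) (top_of_set S) p \<longleftrightarrow> covering_space C p S"
proof -
  have hom: "homeomorphic_map (subtopology (top_of_set C) U) (subtopology (top_of_set S) T) p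
      \<longleftrightarrow> (\<exists>q. homeomorphism U T p q)"
    if "U \<subseteq> C" "T \<subseteq> S" for U T
  proof -
    have "homeomorphic_map (top_of_set U) (top_of_set T) p \<longleftrightarrow> (\<exists>q. homeomorphism U T p q)"
    proof
      assume "homeomorphic_map (top_of_set U) (top_of_set T) p"
      then obtain q where q: "homeomorphic_maps (top_of_set U) (top_of_set T) p q"
        by (auto simp: homeomorphic_map_maps)
      then have "homeomorphism U T p q"
        by (intro homeomorphismI) (auto simp: homeomorphic_maps_def)
      then show "\<exists>q. homeomorphism U T p q"
        by blast
    next
      assume "\<exists>q. homeomorphism U T p q"
      then obtain q where "homeomorphism U T p q"
        by blast
      then have "homeomorphic_maps (top_of_set U) (top_of_set T) p q"
        by (auto simp: homeomorphic_maps_def homeomorphism_def)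
      then show "homeomorphic_map (top_of_set U) (top_of_set T) p"
        by (auto simp: homeomorphic_map_maps)
    qed
    moreover have "C \<inter> U = U" "S \<inter> T = T"
      using that by auto
    ultimately show ?thesis
      by (simp add: subtopology_subtopology)
  qed
  have pieces: "(\<forall>U\<in>V. openin (top_of_set C) U) \<and> pairwise disjnt V \<and>
        (\<forall>U\<in>V. homeomorphic_map (subtopology (top_of_set C) U) (subtopology (top_of_set S) T) p)
      \<longleftrightarrow> (\<forall>U\<in>V. openin (top_of_set C) U) \<and> pairwise disjnt V \<and>
        (\<forall>U\<in>V. \<exists>q. homeomorphism U T p q)"
    if "openin (top_of_set S) T" for T V
    using hom[OF openin_imp_subset openin_imp_subset[OF that]] by (metis (no_types, lifting))
  have local: "(\<exists>T. y \<in> T \<and> openin (top_of_set S) T \<and> (\<exists>V. \<Union>V = C \<inter> p -` T \<and>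
        (\<forall>U\<in>V. openin (top_of_set C) U) \<and> pairwise disjnt V \<and>
        (\<forall>U\<in>V. homeomorphic_map (subtopology (top_of_set C) U) (subtopology (top_of_set S) T) p)))
      \<longleftrightarrow> (\<exists>T. y \<in> T \<and> openin (top_of_set S) T \<and> (\<exists>V. \<Union>V = C \<inter> p -` T \<and>
        (\<forall>U\<in>V. openin (top_of_set C) U) \<and> pairwise disjnt V \<and>
        (\<forall>U\<in>V. \<exists>q. homeomorphism U T p q)))" for y
    by (intro ex_cong1 conj_cong refl pieces)
  show ?thesis
    unfolding covering_map_def covering_space_def local topspace_subtopology topspace_euclidean
      Int_UNIV_left local
    by (auto simp: continuous_map_in_subtopology)
qed

lemma istopology_dual:
  "istopology (\<lambda>W. W \<subseteq> dual_bundle L \<and>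
     (\<forall>T\<in>trivs L. open {(p, a). p \<in> fst T \<and> (p, rescale a (coframe L T p)) \<in> W}))"
proof -
  let ?R = "\<lambda>T W. {(p, a). p \<in> fst T \<and> (p, rescale a (coframe L T p)) \<in> W}"
  have "?R T (W \<inter> W') = ?R T W \<inter> ?R T W'" for T W W'
    by auto
  moreover have "?R T (\<Union>K) = \<Union>(?R T ` K)" for T K
    by auto
  ultimately show ?thesis
    unfolding istopology_def by (auto simp: open_Int intro!: open_Union)
qed

lemma openin_dual_topology:
  "openin (dual_topology L) W \<longleftrightarrow> W \<subseteq> dual_bundle L \<and>
     (\<forall>T\<in>trivs L. open {(p, a). p \<in> fst T \<and> (p, rescale a (coframe L T p)) \<in> W})"
  unfolding dual_topology_def using istopology_dual[of L] by (simp add: topology_inverse')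

end

theory Submission
  imports Defs
begin

text \<open>
  Fix a local frame \<open>e\<close> of \<open>L\<close> and write the points of the dual bundle as \<open>(p, a e\<^sup>*(p))\<close>. Since
  \<open>|e\<^sup>*| = 1 / |e|\<close>, the circle bundle is \<open>{|a| = |e(p)|}\<close>, and on it the lift of the section \<open>f e\<^sup>m\<close>
  is \<open>f(p) a\<^sup>m\<close>. Near a point where \<open>f\<close> does not vanish, \<open>f = |f| e\<^sup>i\<^sup>\<alpha>\<close> with a continuous argument \<open>\<alpha>\<close>.
  Asking for \<open>f a\<^sup>m\<close> to lie on the real line through \<open>e\<^sup>i\<^sup>\<kappa>\<close> amounts to asking for
  \<open>e\<^sup>i\<^sup>(\<^sup>\<alpha>\<^sup>-\<^sup>\<kappa>\<^sup>) (a/|a|)\<^sup>m\<close> to be \<open>1\<close> or \<open>-1\<close>. With the continuous local solution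
  \<open>s = |e| exp(i (\<kappa> - \<alpha>) / m)\<close>, this says that \<open>\<zeta> = a / s(p)\<close> satisfies \<open>\<zeta>\<^sup>m = 1\<close> or \<open>\<zeta>\<^sup>m = -1\<close>, that is,
  \<open>\<zeta>\<close> is one of the \<open>2|m|\<close> complex roots of \<open>\<zeta>\<^sup>2\<^sup>|\<^sup>m\<^sup>| = 1\<close>. So locally the nodal set is the
  disjoint union of the graphs of the sections \<open>\<zeta> s\<close>, and these are the sheets of the covering. The
  zero sets of the imaginary and of the real part are the cases \<open>\<kappa> = 0\<close> and \<open>\<kappa> = \<pi>/2\<close>.

  The topological part, in which a finite set of multiples of a local section gives a covering, is
  \<open>n_fold_covering_of_scaled_finite_set\<close>; the argument above is
  \<open>real_line_preimage_covering\<close>.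
\<close>

section \<open>Local coordinates on the dual bundle\<close>

text \<open>Regularity of functions on the surface is given in charts; this transfers continuity to the
  surface itself.\<close>

lemma continuous_on_from_charts:
  fixes k :: "'x::topological_space \<Rightarrow> 'b::topological_space"
  assumes surface: "riemann_surface atlas" and U: "open U"
    and k: "\<And>c. c \<in> atlas \<Longrightarrow> continuous_on (snd c ` (fst c \<inter> U)) (k \<circ> param c)"
  shows "continuous_on U k"
proof -
  have chart: "open (fst c)" "homeomorphism (fst c) (snd c ` fst c) (snd c) (param c)" if "c \<in> atlas" for c
    using surface that unfolding riemann_surface_def by auto
  have loc: "continuous_on (fst c \<inter> U) k" if c: "c \<in> atlas" for c
  proof -
    have "continuous_on (fst c \<inter> U) (snd c)"
      using chart[OF c] by (meson continuous_on_subset homeomorphism_cont1 inf_le1)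
    then have "continuous_on (fst c \<inter> U) ((k \<circ> param c) \<circ> snd c)"
      using k[OF c] by (rule continuous_on_compose)
    moreover have "((k \<circ> param c) \<circ> snd c) p = k p" if "p \<in> fst c \<inter> U" for p
      using chart(2)[OF c] that by (simp add: homeomorphism_apply1)
    ultimately show ?thesis
      by (rule continuous_on_eq)
  qed
  have "continuous_on (\<Union>c\<in>atlas. fst c \<inter> U) k"
    using chart(1) loc U by (intro continuous_on_open_UN) auto
  moreover have "(\<Union>c\<in>atlas. fst c \<inter> U) = U"
    using surface unfolding riemann_surface_def by auto
  ultimately show ?thesis
    by simp
qed

text \<open>The inverse of the trivialization of the dual bundle that is induced by \<open>T\<close>.\<close>

definition dual_point :: "('x, 'l) line_bundle \<Rightarrow> ('x, 'l) triv \<Rightarrow> 'x \<Rightarrow> complex \<Rightarrow> 'x \<times> ('l \<Rightarrow> complex)" where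
  "dual_point L T p a = (p, rescale a (coframe L T p))"

lemma fst_dual_point [simp]: "fst (dual_point L T p a) = p"
  by (simp add: dual_point_def)

locale line_bundle_on_surface =
  fixes atlas :: "'x::topological_space chart set"
    and L :: "('x, 'l) line_bundle"
  assumes surface: "riemann_surface atlas"
    and holomorphic: "holomorphic_line_bundle atlas L"
begin

lemma open_triv: "T \<in> trivs L \<Longrightarrow> open (fst T)"
  using holomorphic unfolding holomorphic_line_bundle_def by auto

lemma ex_triv: "\<exists>T\<in>trivs L. p \<in> fst T"
  using holomorphic unfolding holomorphic_line_bundle_def by auto

lemma triv_bij:
  "T \<in> trivs L \<Longrightarrow> bij_betw (\<lambda>v. (proj L v, snd T v)) (proj L -` fst T) (fst T \<times> UNIV)"
  using holomorphic unfolding holomorphic_line_bundle_def by auto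

lemma triv_fadd:
  assumes "T \<in> trivs L" "proj L u = p" "proj L v = p" "p \<in> fst T"
  shows "proj L (fadd L u v) = p" "snd T (fadd L u v) = snd T u + snd T v"
  using holomorphic assms unfolding holomorphic_line_bundle_def by auto

lemma triv_fscale:
  assumes "T \<in> trivs L" "proj L v \<in> fst T"
  shows "proj L (fscale L a v) = proj L v" "snd T (fscale L a v) = a * snd T v"
  using holomorphic assms unfolding holomorphic_line_bundle_def by auto

lemma triv_eqI:
  assumes "T \<in> trivs L" "proj L u = proj L v" "proj L v \<in> fst T" "snd T u = snd T v"
  shows "u = v"
  using triv_bij[OF assms(1)] assms unfolding bij_betw_def inj_on_def by auto

lemma frame_in_fibre:
  assumes "T \<in> trivs L" "p \<in> fst T"
  shows "proj L (frame L T p) = p" "snd T (frame L T p) = 1"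
proof -
  have "(p, 1) \<in> (\<lambda>v. (proj L v, snd T v)) ` (proj L -` fst T)"
    using triv_bij[OF assms(1)] assms(2) by (simp add: bij_betw_def)
  then obtain v where v: "proj L v = p" "snd T v = 1"
    by auto
  have "\<exists>!v. proj L v = p \<and> snd T v = 1"
    using v triv_eqI[OF assms(1)] assms(2) by (intro ex1I[of _ v]) auto
  from theI'[OF this] show "proj L (frame L T p) = p" "snd T (frame L T p) = 1"
    by (auto simp: frame_def)
qed

lemma eq_fscale_frame:
  assumes "T \<in> trivs L" "proj L v \<in> fst T"
  shows "v = fscale L (snd T v) (frame L T (proj L v))"
  using assms frame_in_fibre triv_fscale by (intro triv_eqI[of T]) auto

lemma transition_nonzero:
  assumes "T \<in> trivs L" "T' \<in> trivs L" "p \<in> fst T" "p \<in> fst T'"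
  shows "transition L T T' p \<noteq> 0"
proof
  let ?e = "frame L T p"
  assume "transition L T T' p = 0"
  then have "fscale L 0 ?e = ?e"
    using assms frame_in_fibre[of T p] triv_fscale[of T' ?e]
    by (intro triv_eqI[of T']) (auto simp: transition_def)
  then have "snd T ?e = 0"
    using assms frame_in_fibre[of T p] triv_fscale(2)[of T ?e 0] by simp
  then show False
    using assms frame_in_fibre[of T p] by simp
qed

lemma continuous_transition:
  assumes "T \<in> trivs L" "T' \<in> trivs L"
  shows "continuous_on (fst T \<inter> fst T') (transition L T T')"
proof (rule continuous_on_from_charts[OF surface])
  show "open (fst T \<inter> fst T')"
    using assms by (intro open_Int open_triv)
  fix c assume "c \<in> atlas"
  then have "(transition L T T' \<circ> param c) holomorphic_on snd c ` (fst c \<inter> fst T \<inter> fst T')"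
    using holomorphic assms unfolding holomorphic_line_bundle_def by auto
  then show "continuous_on (snd c ` (fst c \<inter> (fst T \<inter> fst T'))) (transition L T T' \<circ> param c)"
    unfolding Int_assoc by (rule holomorphic_on_imp_continuous_on)
qed

text \<open>From \<open>e\<^sub>T = \<gamma> e\<^sub>T\<^sub>'\<close> one gets the opposite rule for the dual frames,
  \<open>e\<^sub>T\<^sub>'\<^sup>* = \<gamma> e\<^sub>T\<^sup>*\<close>.\<close>

lemma dual_point_change:
  assumes "T \<in> trivs L" "T' \<in> trivs L" "p \<in> fst T" "p \<in> fst T'"
  shows "dual_point L T' p a = dual_point L T p (a * transition L T T' p)"
proof -
  have "snd T' v = transition L T T' p * snd T v" if "proj L v = p" for v
    using that assms eq_fscale_frame[of T v] triv_fscale(2)[of T' "frame L T p" "snd T v"]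
      frame_in_fibre[of T p] by (simp add: transition_def)
  then show ?thesis
    by (auto simp: dual_point_def rescale_def coframe_def)
qed

lemma dual_point_in_dual_bundle:
  assumes "T \<in> trivs L" "p \<in> fst T"
  shows "dual_point L T p a \<in> dual_bundle L"
  using assms triv_fadd triv_fscale
  by (auto simp: dual_point_def dual_bundle_def rescale_def coframe_def algebra_simps)

lemma dual_point_frame:
  assumes "T \<in> trivs L" "p \<in> fst T"
  shows "snd (dual_point L T p a) (frame L T p) = a"
  using assms frame_in_fibre by (simp add: dual_point_def rescale_def coframe_def)

lemma dual_point_cases:
  assumes "T \<in> trivs L" "q \<in> dual_bundle L" "fst q \<in> fst T"
  obtains a where "q = dual_point L T (fst q) a"
proof
  obtain p \<xi> where q: "q = (p, \<xi>)"
    by fastforce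
  have "\<xi> v = \<xi> (frame L T p) * (if proj L v = p then snd T v else 0)" for v
  proof (cases "proj L v = p")
    case True
    then have "\<xi> v = \<xi> (fscale L (snd T v) (frame L T p))"
      using eq_fscale_frame[of T v] assms q by auto
    also have "\<dots> = snd T v * \<xi> (frame L T p)"
      using assms q frame_in_fibre[of T p] unfolding dual_bundle_def by auto
    finally show ?thesis
      using True by simp
  next
    case False
    then show ?thesis
      using assms q by (auto simp: dual_bundle_def)
  qed
  then have "\<xi> = rescale (\<xi> (frame L T p)) (coframe L T p)"
    unfolding rescale_def coframe_def by (rule ext)
  then show "q = dual_point L T (fst q) (snd q (frame L T (fst q)))"
    unfolding dual_point_def q fst_conv snd_conv by (rule arg_cong)
qed

lemma dual_point_eq_iff:
  assumes "T \<in> trivs L" "p \<in> fst T"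
  shows "dual_point L T p a = dual_point L T p' b \<longleftrightarrow> p = p' \<and> a = b"
  using dual_point_frame[OF assms] by (metis fst_dual_point)

section \<open>The topology of the dual bundle\<close>

lemma openin_dual_topology_iff:
  "openin (dual_topology L) W \<longleftrightarrow> W \<subseteq> dual_bundle L \<and>
     (\<forall>T\<in>trivs L. open {(p, a). p \<in> fst T \<and> dual_point L T p a \<in> W})"
  by (simp add: openin_dual_topology dual_point_def)

lemma openin_over_open:
  assumes "open N"
  shows "openin (dual_topology L) {q \<in> dual_bundle L. fst q \<in> N}"
  unfolding openin_dual_topology_iff
proof (intro conjI ballI)
  fix T assume T: "T \<in> trivs L"
  have "{(p, a). p \<in> fst T \<and> dual_point L T p a \<in> {q \<in> dual_bundle L. fst q \<in> N}} = (fst T \<inter> N) \<times> UNIV"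
    using dual_point_in_dual_bundle[OF T] by auto
  then show "open {(p, a). p \<in> fst T \<and> dual_point L T p a \<in> {q \<in> dual_bundle L. fst q \<in> N}}"
    using T open_triv assms by (simp add: open_Int open_Times)
qed auto

lemma topspace_dual_topology [simp]: "topspace (dual_topology L) = dual_bundle L"
  using openin_over_open[of UNIV] openin_dual_topology_iff[of "topspace (dual_topology L)"]
  by (auto dest: openin_subset)

lemma continuous_map_fst: "continuous_map (dual_topology L) euclidean fst"
  using openin_over_open by (auto simp: continuous_map)

lemma continuous_map_dual_point:
  assumes T: "T \<in> trivs L" and N: "N \<subseteq> fst T" and s: "continuous_on N s"
  shows "continuous_map (top_of_set N) (dual_topology L) (\<lambda>p. dual_point L T p (s p))"
  unfolding continuous_map
proof (intro conjI allI impI)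
  show "(\<lambda>p. dual_point L T p (s p)) ` topspace (top_of_set N) \<subseteq> topspace (dual_topology L)"
    using dual_point_in_dual_bundle[OF T] N by auto
  fix W assume "openin (dual_topology L) W"
  then have "open {(p, a). p \<in> fst T \<and> dual_point L T p a \<in> W}" (is "open ?W")
    using T by (simp add: openin_dual_topology_iff)
  moreover have "continuous_on N (\<lambda>p. (p, s p))"
    using s by (intro continuous_intros)
  ultimately have "openin (top_of_set N) (N \<inter> (\<lambda>p. (p, s p)) -` ?W)"
    by (rule continuous_openin_preimage_gen[rotated])
  also have "N \<inter> (\<lambda>p. (p, s p)) -` ?W = {p \<in> topspace (top_of_set N). dual_point L T p (s p) \<in> W}"
    using N by auto
  finally show "openin (top_of_set N) {p \<in> topspace (top_of_set N). dual_point L T p (s p) \<in> W}" .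
qed

text \<open>The trivializations are not only continuous but open. Openness has to be tested in every other
  trivialization \<open>T'\<close>, where the image of \<open>W\<close> is its preimage under \<open>(p, a) \<mapsto> (p, \<gamma>(p) a)\<close>, which is
  continuous because the transition functions are.\<close>

lemma openin_image_dual_point:
  assumes T: "T \<in> trivs L" and W: "open W" "W \<subseteq> fst T \<times> UNIV"
  shows "openin (dual_topology L) ((\<lambda>(p, a). dual_point L T p a) ` W)"
  unfolding openin_dual_topology_iff
proof (intro conjI ballI)
  show "(\<lambda>(p, a). dual_point L T p a) ` W \<subseteq> dual_bundle L"
    using W dual_point_in_dual_bundle[OF T] by auto
  fix T' assume T': "T' \<in> trivs L"
  let ?D = "(fst T \<inter> fst T') \<times> (UNIV :: complex set)"
  let ?k = "\<lambda>x. (fst x, snd x * transition L T T' (fst x))"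
  have "continuous_on ?D (\<lambda>x. transition L T T' (fst x))"
    by (rule continuous_on_compose2[OF continuous_transition[OF T T']]) (auto intro: continuous_on_fst continuous_on_id)
  then have "continuous_on ?D ?k"
    by (intro continuous_intros)
  moreover have "open ?D"
    using open_triv T T' by (simp add: open_Int open_Times)
  ultimately have "open (?D \<inter> ?k -` W)"
    using W(1) by (rule continuous_open_preimage)
  also have "?D \<inter> ?k -` W = {(p, a). p \<in> fst T' \<and> dual_point L T' p a \<in> (\<lambda>(p, a). dual_point L T p a) ` W}"
    (is "?L = ?R")
  proof (intro set_eqI iffI)
    fix x assume "x \<in> ?L"
    then show "x \<in> ?R"
      using dual_point_change[OF T T'] by (cases x) (auto intro!: image_eqI[where x = "?k x"])
  next
    fix x assume x: "x \<in> ?R"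
    obtain p a where pa: "x = (p, a)"
      by fastforce
    obtain b where b: "(p, b) \<in> W" "dual_point L T' p a = dual_point L T p b"
      using x pa by (auto) (metis fst_dual_point)
    then show "x \<in> ?L"
      using x W(2) T dual_point_change[OF T T', of p a] dual_point_eq_iff[OF T, of p "a * transition L T T' p" p b] pa
      by auto
  qed
  finally show "open {(p, a). p \<in> fst T' \<and> dual_point L T' p a \<in> (\<lambda>(p, a). dual_point L T p a) ` W}" .
qed

section \<open>Coverings by finitely many multiples of local sections\<close>

text \<open>Dividing the fibre coordinate by \<open>s\<close> turns \<open>C\<close> over \<open>N\<close> into \<open>N \<times> R\<close>. A finite subset of \<open>\<complex>\<close> is
  discrete, so the pieces \<open>N \<times> {\<zeta>}\<close> are open in \<open>C\<close>, and the section \<open>\<zeta> s\<close> is the inverse of the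
  projection on such a piece. Only the set \<open>R\<close> has to be the same at all base points; \<open>s\<close> need not
  extend globally, so the covering may be nontrivial.\<close>

lemma n_fold_covering_of_scaled_finite_set:
  fixes R :: "complex set"
  assumes R: "finite R" "R \<noteq> {}"
    and C: "C \<subseteq> dual_bundle L" "fst ` C \<subseteq> S"
    and local: "\<And>y. y \<in> S \<Longrightarrow> \<exists>T\<in>trivs L. \<exists>N s. open N \<and> y \<in> N \<and> N \<subseteq> S \<inter> fst T \<and>
        continuous_on N s \<and> (\<forall>p\<in>N. s p \<noteq> 0) \<and>
        (\<forall>p\<in>N. \<forall>a. dual_point L T p a \<in> C \<longleftrightarrow> a / s p \<in> R)"
  shows "n_fold_covering_map (card R) (subtopology (dual_topology L) C) (top_of_set S) fst"
proof -
  let ?X = "subtopology (dual_topology L) C"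
  have topX: "topspace ?X = C"
    using C by auto
  have fibre: "finite {q \<in> C. fst q = y} \<and> card {q \<in> C. fst q = y} = card R" if y: "y \<in> S" for y
  proof -
    obtain T N s where T: "T \<in> trivs L" and N: "y \<in> N" "N \<subseteq> S \<inter> fst T" and s: "s y \<noteq> 0"
      and mem: "\<And>a. dual_point L T y a \<in> C \<longleftrightarrow> a / s y \<in> R"
      using local[OF y] by blast
    have yT: "y \<in> fst T"
      using N by auto
    have "bij_betw (\<lambda>\<zeta>. dual_point L T y (s y * \<zeta>)) R {q \<in> C. fst q = y}"
    proof (rule bij_betwI')
      fix \<zeta> \<zeta>'
      show "dual_point L T y (s y * \<zeta>) = dual_point L T y (s y * \<zeta>') \<longleftrightarrow> \<zeta> = \<zeta>'"
        using dual_point_eq_iff[OF T yT] s by simp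
    next
      fix \<zeta> assume "\<zeta> \<in> R"
      then show "dual_point L T y (s y * \<zeta>) \<in> {q \<in> C. fst q = y}"
        using mem s by simp
    next
      fix q assume q: "q \<in> {q \<in> C. fst q = y}"
      then obtain a where a: "q = dual_point L T y a"
        using dual_point_cases[OF T, of q] C yT by auto
      then show "\<exists>\<zeta>\<in>R. q = dual_point L T y (s y * \<zeta>)"
        using q mem s by (intro bexI[of _ "a / s y"]) auto
    qed
    then show ?thesis
      using R by (simp add: bij_betw_finite[symmetric] bij_betw_same_card[symmetric])
  qed
  have evenly: "\<exists>N. y \<in> N \<and> openin (top_of_set S) N \<and>
      (\<exists>V. \<Union>V = C \<inter> fst -` N \<and> (\<forall>U\<in>V. openin ?X U) \<and> pairwise disjnt V \<and>
         (\<forall>U\<in>V. homeomorphic_map (subtopology ?X U) (subtopology (top_of_set S) N) fst))"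
    if y: "y \<in> S" for y
  proof -
    obtain T N s where T: "T \<in> trivs L" and N: "open N" "y \<in> N" "N \<subseteq> S" "N \<subseteq> fst T"
      and s: "continuous_on N s" "\<And>p. p \<in> N \<Longrightarrow> s p \<noteq> 0"
      and mem: "\<And>p a. p \<in> N \<Longrightarrow> dual_point L T p a \<in> C \<longleftrightarrow> a / s p \<in> R"
      using local[OF y] by (metis le_inf_iff)
    define sheet where "sheet \<zeta> = (\<lambda>p. dual_point L T p (s p * \<zeta>)) ` N" for \<zeta>
    have sheet_mem: "dual_point L T p a \<in> sheet \<zeta> \<longleftrightarrow> p \<in> N \<and> a = s p * \<zeta>" if "p \<in> fst T" for p a \<zeta>
      using dual_point_eq_iff[OF T that] by (auto simp: sheet_def)
    have sheetC: "sheet \<zeta> \<subseteq> C" if "\<zeta> \<in> R" for \<zeta>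
      using mem s(2) that by (auto simp: sheet_def)
    have cover: "\<Union>(sheet ` R) = C \<inter> fst -` N"
    proof (intro set_eqI iffI)
      fix q assume "q \<in> C \<inter> fst -` N"
      then have q: "q \<in> C" "fst q \<in> N" "q \<in> dual_bundle L" "fst q \<in> fst T"
        using C N by auto
      then obtain a where a: "q = dual_point L T (fst q) a"
        using dual_point_cases[OF T] by blast
      have R': "a / s (fst q) \<in> R"
        using q(1,2) a mem[of "fst q" a] by simp
      moreover have "q = dual_point L T (fst q) (s (fst q) * (a / s (fst q)))"
        using a s(2)[OF q(2)] by simp
      then have "q \<in> sheet (a / s (fst q))"
        unfolding sheet_def using q(2) by blast
      ultimately show "q \<in> \<Union>(sheet ` R)"
        by blast
    next
      fix q assume "q \<in> \<Union>(sheet ` R)"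
      then show "q \<in> C \<inter> fst -` N"
        using sheetC by (auto simp: sheet_def)
    qed
    have sheet_open: "openin ?X (sheet \<zeta>)" if \<zeta>: "\<zeta> \<in> R" for \<zeta>
    proof -
      \<comment> \<open>The complement of the other points of \<open>R\<close> is an open set that isolates \<open>\<zeta>\<close> in \<open>R\<close>.\<close>
      let ?q = "\<lambda>x. snd x / s (fst x)"
      let ?W = "N \<times> UNIV \<inter> ?q -` (- (R - {\<zeta>}))"
      have "continuous_on (N \<times> UNIV) (\<lambda>x. s (fst x))"
        by (rule continuous_on_compose2[OF s(1)]) (auto intro: continuous_on_fst continuous_on_id)
      then have "continuous_on (N \<times> UNIV) ?q"
        using s(2) by (intro continuous_intros) auto
      moreover have "open (N \<times> (UNIV :: complex set))"
        using N by (simp add: open_Times)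
      moreover have "open (- (R - {\<zeta>}))"
        using R by (intro open_Compl finite_imp_closed finite_Diff)
      ultimately have "open ?W"
        by (rule continuous_open_preimage)
      then have "openin (dual_topology L) ((\<lambda>(p, a). dual_point L T p a) ` ?W)"
        using N by (intro openin_image_dual_point[OF T]) auto
      moreover have "sheet \<zeta> = (\<lambda>(p, a). dual_point L T p a) ` ?W \<inter> C"
      proof (intro set_eqI iffI)
        fix q assume "q \<in> sheet \<zeta>"
        then obtain p where p: "p \<in> N" "q = dual_point L T p (s p * \<zeta>)"
          by (auto simp: sheet_def)
        then have "(p, s p * \<zeta>) \<in> ?W"
          using s(2) by auto
        then show "q \<in> (\<lambda>(p, a). dual_point L T p a) ` ?W \<inter> C"
          using p sheetC[OF \<zeta>] \<open>q \<in> sheet \<zeta>\<close> by (auto intro!: image_eqI[where x = "(p, s p * \<zeta>)"])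
      next
        fix q assume "q \<in> (\<lambda>(p, a). dual_point L T p a) ` ?W \<inter> C"
        then obtain p a where p: "p \<in> N" "a / s p \<notin> R - {\<zeta>}" "q = dual_point L T p a" "q \<in> C"
          by fastforce
        then have "a / s p = \<zeta>"
          using mem by auto
        then have "a = s p * \<zeta>"
          using s(2) p by auto
        then show "q \<in> sheet \<zeta>"
          using p by (auto simp: sheet_def)
      qed
      ultimately show ?thesis
        by (auto simp: openin_subtopology)
    qed
    have disj: "pairwise disjnt (sheet ` R)"
    proof (rule pairwiseI, clarify)
      fix \<zeta> \<zeta>' assume "sheet \<zeta> \<noteq> sheet \<zeta>'"
      then have ne: "\<zeta> \<noteq> \<zeta>'"
        by auto
      show "disjnt (sheet \<zeta>) (sheet \<zeta>')"
        unfolding disjnt_iff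
      proof (intro allI notI, elim conjE)
        fix q assume q: "q \<in> sheet \<zeta>" "q \<in> sheet \<zeta>'"
        from q(1) obtain p where p: "p \<in> N" "q = dual_point L T p (s p * \<zeta>)"
          by (auto simp: sheet_def)
        then have "s p * \<zeta> = s p * \<zeta>'"
          using q(2) sheet_mem[of p] N by auto
        then show False
          using s(2) p ne by simp
      qed
    qed
    have homeo: "homeomorphic_map (subtopology ?X (sheet \<zeta>)) (subtopology (top_of_set S) N) fst"
      if \<zeta>: "\<zeta> \<in> R" for \<zeta>
    proof -
      have X: "subtopology ?X (sheet \<zeta>) = subtopology (dual_topology L) (sheet \<zeta>)"
        using sheetC[OF \<zeta>] by (simp add: subtopology_subtopology Int_absorb1)
      have Y: "subtopology (top_of_set S) N = top_of_set N"
        using N by (simp add: subtopology_subtopology Int_absorb1)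
      have "continuous_map (top_of_set N) (dual_topology L) (\<lambda>p. dual_point L T p (s p * \<zeta>))"
        using s by (intro continuous_map_dual_point T N continuous_intros)
      then have "homeomorphic_maps (subtopology (dual_topology L) (sheet \<zeta>)) (top_of_set N) fst
          (\<lambda>p. dual_point L T p (s p * \<zeta>))"
        unfolding homeomorphic_maps_def
        by (auto simp: continuous_map_in_subtopology sheet_def
            intro!: continuous_map_from_subtopology continuous_map_fst)
      then show ?thesis
        unfolding X Y homeomorphic_map_maps by blast
    qed
    have "openin (top_of_set S) N"
      using N by (auto simp: openin_open)
    then show ?thesis
      using N(2) cover sheet_open disj homeo
      by (intro exI[of _ N] conjI exI[of _ "sheet ` R"]) auto
  qed
  have "fst ` C = S"
  proof
    show "S \<subseteq> fst ` C"
    proof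
      fix y assume "y \<in> S"
      then have "card {q \<in> C. fst q = y} \<noteq> 0"
        using fibre R by simp
      then show "y \<in> fst ` C"
        by (metis (mono_tags, lifting) card.empty empty_Collect_eq image_eqI)
    qed
  qed (use C in auto)
  moreover have "continuous_map ?X (top_of_set S) fst"
    using C by (auto simp: continuous_map_in_subtopology
        intro!: continuous_map_from_subtopology continuous_map_fst)
  ultimately have "covering_map ?X (top_of_set S) fst"
    unfolding covering_map_def topspace_euclidean_subtopology topX
    by (intro conjI ballI evenly)
  then show ?thesis
    unfolding n_fold_covering_map_def topspace_euclidean_subtopology topX
    by (intro conjI ballI fibre[THEN conjunct1] fibre[THEN conjunct2])
qed

end

section \<open>The circle bundle in local coordinates\<close>

locale hermitian_line_bundle_on_surface = line_bundle_on_surface atlas L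
  for atlas :: "'x::topological_space chart set" and L :: "('x, 'l) line_bundle" +
  fixes h :: "'l \<Rightarrow> 'l \<Rightarrow> complex"
  assumes hermitian: "hermitian_metric atlas L h"
begin

definition frame_norm :: "('x, 'l) triv \<Rightarrow> 'x \<Rightarrow> real" where
  "frame_norm T p = sqrt (Re (h (frame L T p) (frame L T p)))"

lemma frame_norm_pos:
  assumes "T \<in> trivs L" "p \<in> fst T"
  shows "frame_norm T p > 0"
proof -
  have "snd T (frame L T p) \<noteq> snd T (fscale L 0 (frame L T p))"
    using frame_in_fibre[OF assms] triv_fscale[of T "frame L T p" 0] assms by simp
  then have "frame L T p \<noteq> fscale L 0 (frame L T p)"
    by metis
  then have "0 < Re (h (frame L T p) (frame L T p))"
    using hermitian unfolding hermitian_metric_def by blast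
  then show ?thesis
    by (simp add: frame_norm_def)
qed

lemma continuous_frame_norm:
  assumes "T \<in> trivs L"
  shows "continuous_on (fst T) (frame_norm T)"
proof -
  have "continuous_on (fst T) (\<lambda>p. h (frame L T p) (frame L T p))"
  proof (rule continuous_on_from_charts[OF surface])
    fix c assume "c \<in> atlas"
    then have "smooth_on (\<lambda>z. h (frame L T (param c z)) (frame L T (param c z))) (snd c ` (fst c \<inter> fst T))"
      using hermitian assms unfolding hermitian_metric_def by blast
    then have "ck_on 0 (\<lambda>z. h (frame L T (param c z)) (frame L T (param c z))) (snd c ` (fst c \<inter> fst T))"
      unfolding smooth_on_def by blast
    then show "continuous_on (snd c ` (fst c \<inter> fst T)) ((\<lambda>p. h (frame L T p) (frame L T p)) \<circ> param c)"
      by (simp add: o_def)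
  qed (use assms open_triv in auto)
  then show ?thesis
    unfolding frame_norm_def by (intro continuous_intros)
qed

lemma norm_in_frame:
  assumes "T \<in> trivs L" "proj L v \<in> fst T"
  shows "sqrt (Re (h v v)) = cmod (snd T v) * frame_norm T (proj L v)"
proof -
  let ?e = "frame L T (proj L v)" and ?b = "snd T v"
  have v: "v = fscale L ?b ?e"
    using eq_fscale_frame[OF assms] .
  have e: "proj L ?e = proj L v"
    using frame_in_fibre[OF assms] by simp
  have sesq: "h (fscale L a u) w = a * h u w" "h w u = cnj (h u w)"
    if "proj L u = proj L w" for a u w
    using hermitian that unfolding hermitian_metric_def by blast+
  have "h v v = ?b * h ?e v"
    using sesq(1)[of ?e v ?b] e v by simp
  also have "h ?e v = cnj (h v ?e)"
    using sesq(2)[of v ?e] e by simp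
  also have "h v ?e = ?b * h ?e ?e"
    using sesq(1)[of ?e ?e ?b] v by simp
  finally have "h v v = (?b * cnj ?b) * cnj (h ?e ?e)"
    by simp
  then have "Re (h v v) = (cmod ?b)\<^sup>2 * Re (h ?e ?e)"
    by (simp only: complex_norm_square[symmetric] Re_complex_of_real Im_complex_of_real
        times_complex.simps complex_cnj) simp
  then show ?thesis
    by (simp add: frame_norm_def real_sqrt_mult)
qed

text \<open>The supremum in the dual norm is attained at the unit vector \<open>e\<^sub>T / |e\<^sub>T|\<close>.\<close>

lemma dual_norm_dual_point:
  assumes "T \<in> trivs L" "p \<in> fst T"
  shows "dual_norm L h (dual_point L T p a) = cmod a / frame_norm T p"
proof -
  let ?r = "frame_norm T p"
  have r: "?r > 0"
    using frame_norm_pos[OF assms] .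
  let ?B = "{v. proj L v = p \<and> sqrt (Re (h v v)) \<le> 1}"
  have "Sup ((\<lambda>v. cmod (snd (dual_point L T p a) v)) ` ?B) = cmod a / ?r"
  proof (rule cSup_eq_maximum)
    let ?u = "fscale L (complex_of_real (1 / ?r)) (frame L T p)"
    have u: "proj L ?u = p" "snd T ?u = of_real (1 / ?r)"
      using frame_in_fibre[OF assms] triv_fscale[of T "frame L T p"] assms by auto
    then have "sqrt (Re (h ?u ?u)) = 1"
      using norm_in_frame[of T ?u] assms r by (simp add: norm_divide)
    moreover have "cmod (snd (dual_point L T p a) ?u) = cmod a / ?r"
      using u r by (simp add: dual_point_def rescale_def coframe_def norm_mult norm_divide)
    ultimately show "cmod a / ?r \<in> (\<lambda>v. cmod (snd (dual_point L T p a) v)) ` ?B"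
      using u by (intro image_eqI[where x = ?u]) auto
  next
    fix x assume "x \<in> (\<lambda>v. cmod (snd (dual_point L T p a) v)) ` ?B"
    then obtain v where v: "proj L v = p" "sqrt (Re (h v v)) \<le> 1"
      and x: "x = cmod a * cmod (snd T v)"
      by (auto simp: dual_point_def rescale_def coframe_def norm_mult)
    have "cmod (snd T v) \<le> 1 / ?r"
      using norm_in_frame[of T v] v assms r by (simp add: field_simps)
    then show "x \<le> cmod a / ?r"
      unfolding x using mult_left_mono[of "cmod (snd T v)" "1 / ?r" "cmod a"] by simp
  qed
  then show ?thesis
    by (simp add: dual_norm_def)
qed

lemma dual_point_in_circle_bundle_iff:
  assumes "T \<in> trivs L" "p \<in> fst T"
  shows "dual_point L T p a \<in> circle_bundle L h \<longleftrightarrow> cmod a = frame_norm T p"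
  using dual_point_in_dual_bundle[OF assms] dual_norm_dual_point[OF assms] frame_norm_pos[OF assms]
  by (auto simp: circle_bundle_def)

end

section \<open>Nodal sets of lifts of sections\<close>

text \<open>On the unit circle the real numbers are \<open>1\<close> and \<open>-1\<close>, the solutions of \<open>w\<^sup>2 = 1\<close>; here
  \<open>w = \<zeta>\<^sup>m\<close>. For negative \<open>m\<close> the equation \<open>\<zeta>\<^sup>2\<^sup>m = 1\<close> is inverted.\<close>

lemma Im_powi_zero_iff_root_of_unity:
  fixes \<zeta> :: complex
  assumes "cmod \<zeta> = 1"
  shows "Im (\<zeta> powi m) = 0 \<longleftrightarrow> \<zeta> ^ nat (2 * \<bar>m\<bar>) = 1"
proof -
  let ?w = "\<zeta> powi m"
  have w: "cmod ?w = 1"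
    using assms by (simp add: norm_power_int)
  have "Im ?w = 0 \<longleftrightarrow> ?w\<^sup>2 = 1"
  proof
    assume im: "Im ?w = 0"
    then have "\<bar>Re ?w\<bar> = 1"
      using w by (simp add: cmod_eq_Re)
    then have "?w = 1 \<or> ?w = - 1"
      using im by (auto simp: complex_eq_iff)
    then show "?w\<^sup>2 = 1"
      by auto
  qed (auto simp: power2_eq_1_iff)
  also have "?w\<^sup>2 = \<zeta> powi (2 * m)"
    using power_int_power'[of \<zeta> m 2] by (simp add: mult.commute)
  also have "\<zeta> powi (2 * m) = 1 \<longleftrightarrow> \<zeta> ^ nat (2 * \<bar>m\<bar>) = 1"
    by (cases "m \<ge> 0") (auto simp: power_int_def power_inverse inverse_eq_1_iff)
  finally show ?thesis .
qed

context hermitian_line_bundle_on_surface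
begin

lemma continuous_section_coefficient:
  assumes sec: "power_section atlas L m f" and T: "T \<in> trivs L"
  shows "continuous_on (fst T) (f T)"
proof (rule continuous_on_from_charts[OF surface open_triv[OF T]])
  fix c assume "c \<in> atlas"
  then have "ck_on 0 (f T \<circ> param c) (snd c ` (fst c \<inter> fst T))"
    using sec T unfolding power_section_def smooth_on_def by blast
  then show "continuous_on (snd c ` (fst c \<inter> fst T)) (f T \<circ> param c)"
    by simp
qed

text \<open>The transition functions have no zeros, so one trivialization decides whether the section
  vanishes.\<close>

lemma section_zeros_iff:
  assumes sec: "power_section atlas L m f" and T: "T \<in> trivs L" "p \<in> fst T"
  shows "p \<in> section_zeros L f \<longleftrightarrow> f T p = 0"
proof
  assume "p \<in> section_zeros L f"
  then obtain T' where T': "T' \<in> trivs L" "p \<in> fst T'" "f T' p = 0"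
    by (auto simp: section_zeros_def)
  moreover have "f T' p = transition L T T' p powi m * f T p"
    using sec T T' unfolding power_section_def by blast
  ultimately show "f T p = 0"
    using transition_nonzero T by simp
qed (use T in \<open>auto simp: section_zeros_def\<close>)

text \<open>The condition on \<open>\<phi>\<close> says that its value lies on the real line through \<open>cis \<kappa>\<close>, which treats the
  real and the imaginary part at once.\<close>

theorem real_line_preimage_covering:
  assumes m: "m \<noteq> 0" and sec: "power_section atlas L m f" and lift: "lift_of L h m f \<phi>"
  shows "n_fold_covering_map (nat (2 * \<bar>m\<bar>))
           (subtopology (dual_topology L)
             ({q \<in> circle_bundle L h. Im (cis (- \<kappa>) * \<phi> q) = 0} -
              {q \<in> circle_bundle L h. fst q \<in> section_zeros L f}))
           (top_of_set (UNIV - section_zeros L f)) fst"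
proof -
  let ?n = "nat (2 * \<bar>m\<bar>)"
  let ?C = "{q \<in> circle_bundle L h. Im (cis (- \<kappa>) * \<phi> q) = 0} -
              {q \<in> circle_bundle L h. fst q \<in> section_zeros L f}"
  let ?R = "{\<zeta>::complex. \<zeta> ^ ?n = 1}"
  have n: "?n > 0"
    using m by simp
  have cardR: "card ?R = ?n"
    using n by (rule card_roots_unity_eq)
  have "n_fold_covering_map (card ?R) (subtopology (dual_topology L) ?C)
      (top_of_set (UNIV - section_zeros L f)) fst"
  proof (rule n_fold_covering_of_scaled_finite_set)
    show "finite ?R"
      using n cardR by (intro card_ge_0_finite) simp
    show "?R \<noteq> {}"
      by (auto intro: exI[of _ 1])
    show "?C \<subseteq> dual_bundle L" "fst ` ?C \<subseteq> UNIV - section_zeros L f"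
      by (auto simp: circle_bundle_def)
    fix y assume y: "y \<in> UNIV - section_zeros L f"
    obtain T where T: "T \<in> trivs L" "y \<in> fst T"
      using ex_triv by blast
    have fy: "f T y \<noteq> 0"
      using section_zeros_iff[OF sec T] y by simp
    have cf: "continuous_on (fst T) (\<lambda>p. f T p / f T y)"
      using continuous_section_coefficient[OF sec T(1)] fy by (intro continuous_intros) auto
    \<comment> \<open>Normalizing by the value at \<open>y\<close> keeps \<open>f\<close> away from the branch cut of \<open>Arg\<close> near \<open>y\<close>. Zeros of
      \<open>f\<close> are excluded as well, since \<open>0\<close> lies on the cut.\<close>
    define N where "N = fst T \<inter> (\<lambda>p. f T p / f T y) -` (- \<real>\<^sub>\<le>\<^sub>0)"
    have N: "open N" "y \<in> N" "N \<subseteq> fst T"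
      using cf open_triv[OF T(1)] T fy by (auto simp: N_def intro!: continuous_open_preimage open_Compl)
    have fN: "f T p \<noteq> 0" if "p \<in> N" for p
      using that by (auto simp: N_def)
    have NS: "N \<subseteq> (UNIV - section_zeros L f) \<inter> fst T"
      using fN N section_zeros_iff[OF sec T(1)] by blast
    define \<alpha> where "\<alpha> p = Arg (f T p / f T y) + Arg (f T y)" for p
    have polar: "f T p = cmod (f T p) * cis (\<alpha> p)" if "p \<in> N" for p
    proof -
      have "cis (\<alpha> p) = sgn (f T p / f T y) * sgn (f T y)"
        using fN[OF that] fy by (simp add: \<alpha>_def cis_Arg flip: cis_mult)
      also have "\<dots> = sgn (f T p)"
        using fy by (simp only: sgn_mult[symmetric]) simp
      finally show ?thesis
        by (simp add: sgn_eq fN[OF that])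
    qed
    have c\<alpha>: "continuous_on N \<alpha>"
      unfolding \<alpha>_def using cf N
      by (intro continuous_intros continuous_on_subset[OF cf]) (auto simp: N_def)
    \<comment> \<open>A point of the circle over \<open>p\<close> at which \<open>\<phi>\<close> is a positive multiple of \<open>cis \<kappa>\<close>.\<close>
    define s where "s p = frame_norm T p * cis ((\<kappa> - \<alpha> p) / m)" for p
    have cs: "continuous_on N s"
      unfolding s_def using c\<alpha> m continuous_on_subset[OF continuous_frame_norm[OF T(1)] N(3)]
      by (intro continuous_intros) auto
    have rN: "frame_norm T p > 0" if "p \<in> N" for p
      using frame_norm_pos[OF T(1)] N(3) that by blast
    have s0: "s p \<noteq> 0" if "p \<in> N" for p
      using rN[OF that] by (simp add: s_def)
    have mem: "dual_point L T p a \<in> ?C \<longleftrightarrow> a / s p \<in> ?R" if p: "p \<in> N" for p a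
    proof -
      have pT: "p \<in> fst T" and pZ: "p \<notin> section_zeros L f"
        using p N NS by auto
      define \<zeta> where "\<zeta> = a / s p"
      have a: "a = s p * \<zeta>"
        using s0[OF p] by (simp add: \<zeta>_def)
      have circ: "dual_point L T p a \<in> circle_bundle L h \<longleftrightarrow> cmod \<zeta> = 1"
        using dual_point_in_circle_bundle_iff[OF T(1) pT, of a] rN[OF p]
        by (simp add: a s_def norm_mult)
      have val: "Im (cis (- \<kappa>) * \<phi> (dual_point L T p a)) = 0 \<longleftrightarrow> Im (\<zeta> powi m) = 0"
        if c: "cmod \<zeta> = 1"
      proof -
        have "\<phi> (dual_point L T p a) = f T p * a powi m"
          using lift T(1) pT circ c dual_point_frame[OF T(1) pT, of a]
          unfolding lift_of_def dual_point_def by fastforce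
        also have "a powi m = frame_norm T p powi m * cis (\<kappa> - \<alpha> p) * \<zeta> powi m"
          using m by (simp add: a s_def power_int_mult_distrib cis_power_int)
        finally have "cis (- \<kappa>) * \<phi> (dual_point L T p a) =
            of_real (cmod (f T p) * frame_norm T p powi m) *
              (cis (- \<kappa>) * cis (\<alpha> p) * cis (\<kappa> - \<alpha> p)) * \<zeta> powi m"
          by (subst (asm) polar[OF p]) (simp add: mult_ac)
        also have "cis (- \<kappa>) * cis (\<alpha> p) * cis (\<kappa> - \<alpha> p) = 1"
          by (simp add: cis_mult)
        finally have "Im (cis (- \<kappa>) * \<phi> (dual_point L T p a)) =
            (cmod (f T p) * frame_norm T p powi m) * Im (\<zeta> powi m)"
          by (simp del: of_real_mult)
        then show ?thesis
          using fN[OF p] rN[OF p] by simp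
      qed
      have "cmod \<zeta> = 1" if "\<zeta> ^ ?n = 1"
        using power_eq_1_iff[OF that] n by auto
      then show ?thesis
        using circ val Im_powi_zero_iff_root_of_unity pZ by (auto simp flip: \<zeta>_def)
    qed
    show "\<exists>T\<in>trivs L. \<exists>N s. open N \<and> y \<in> N \<and> N \<subseteq> (UNIV - section_zeros L f) \<inter> fst T \<and>
        continuous_on N s \<and> (\<forall>p\<in>N. s p \<noteq> 0) \<and>
        (\<forall>p\<in>N. \<forall>a. dual_point L T p a \<in> ?C \<longleftrightarrow> a / s p \<in> ?R)"
      using T(1) N(1,2) NS cs s0 mem by blast
  qed
  then show ?thesis
    unfolding cardR .
qed

end

theorem proposition1p8:
  fixes atlas :: "'x::{t2_space, second_countable_topology} chart set"
    and g :: "'x metric"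
    and L :: "('x, 'l) line_bundle"
    and h :: "'l \<Rightarrow> 'l \<Rightarrow> complex"
    and A :: "('x, 'l) connection"
    and G :: "('x, 'l) circle_metric"
    and m :: int
    and \<mu> :: real
    and \<phi> :: "'x \<times> ('l \<Rightarrow> complex) \<Rightarrow> complex"
    and f :: "('x, 'l) triv \<Rightarrow> 'x \<Rightarrow> complex"
  assumes "compact (UNIV :: 'x set)" and "connected (UNIV :: 'x set)"
    and "riemann_surface atlas"
    and "riemannian_metric atlas g" and "complex_compatible atlas g"
    and "holomorphic_line_bundle atlas L"
    and "hermitian_metric atlas L h"
    and "connection atlas L A" and "metric_connection atlas L h A"
    and "kaluza_klein_metric atlas g L h A G"
    and "m \<noteq> 0"
    and "joint_eigenfunction atlas L h G \<mu> m \<phi>"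
    and "power_section atlas L m f" and "lift_of L h m f \<phi>"
  shows "n_fold_covering_map (nat (2 * \<bar>m\<bar>))
           (subtopology (dual_topology L)
             ({q \<in> circle_bundle L h. Re (\<phi> q) = 0} -
              {q \<in> circle_bundle L h. fst q \<in> section_zeros L f}))
           (top_of_set (UNIV - section_zeros L f)) fst \<and>
         n_fold_covering_map (nat (2 * \<bar>m\<bar>))
           (subtopology (dual_topology L)
             ({q \<in> circle_bundle L h. Im (\<phi> q) = 0} -
              {q \<in> circle_bundle L h. fst q \<in> section_zeros L f}))
           (top_of_set (UNIV - section_zeros L f)) fst"
proof -
  interpret hermitian_line_bundle_on_surface atlas L h
    using assms by unfold_locales
  have half_turn: "Im (cis (- (pi / 2)) * w) = 0 \<longleftrightarrow> Re w = 0" for w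
    by (simp add: cis.code)
  show ?thesis
    using real_line_preimage_covering[OF \<open>m \<noteq> 0\<close> \<open>power_section atlas L m f\<close> \<open>lift_of L h m f \<phi>\<close>, of "pi / 2"]
      real_line_preimage_covering[OF \<open>m \<noteq> 0\<close> \<open>power_section atlas L m f\<close> \<open>lift_of L h m f \<phi>\<close>, of 0]
    by (simp only: half_turn) simp
qed

end
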